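(* Let $J\subset(0,\infty)$ be a compact interval and suppose $d_J:=\inf_{\omega\in J,\ s^*_j\in\mathcal P}|i\omega-s_j^*|>0$, where $\mathcal P=\{s_j^*\}$ is the pole set of the transfer matrix $H_b$. Under the asymptotic scaling $C_i(\varepsilon)=\varepsilon\widetilde C_i$, there exists a constant $C_J>0$ independent of $\varepsilon$ such that $$\sup_{\omega\in J}\|H_b(i\omega)\|_{\mathcal L(\mathbb C^M,\mathbb C^M)}\le\varepsilon\,\frac{C_J}{d_J}.$$ Furthermore, if $H_b(i\omega)$ admits a measurable right inverse $H_b(i\omega)^{\#}$, $\omega\in J$, then its operator norm diverges as $\varepsilon\to0$: $$\operatorname*{ess\,sup}_{\omega\in J}\|H_b(i\omega)^{\#}\|\ge\frac1{\sup_{\omega\in J}\|H_b(i\omega)\|}\ge\frac{d_J}{\varepsilon\,C_J}.$$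
   Context: $p\in(0,1)$, $0<\varepsilon\ll1$, $c_0>0$. There are $M$ bubbles with centers $z_i\in\mathbb R^3$ and a partition $\{1,\dots,M\}=\bigsqcup_{\alpha=1}^N\mathcal I_\alpha$. Each bubble has an $\varepsilon$-independent Minnaert frequency $\omega_{M,i}>0$, with $\omega_{M,i}=\omega_{M,\alpha}$ for all $i\in\mathcal I_\alpha$ and $\omega_{M,\alpha}\ne\omega_{M,\beta}$ for $\alpha\ne\beta$. There are $\varepsilon$-independent $c_1,c_2,D_{\min},D_{\max}>0$ with $d_{ij}=|z_i-z_j|\in[c_1\varepsilon^p,c_2\varepsilon^p]$ for $i\ne j$ in the same cluster and $d_{ij}\in[D_{\min},D_{\max}]$ for $i,j$ in different clusters. With $\varepsilon$-independent constants $\widetilde C_i>0$, $C_i(\varepsilon)=\varepsilon\widetilde C_i$, $\tau_{ij}=d_{ij}/c_0$, the microscopic transfer matrix is $$H_b(s)=\mathcal A_b\,\bigl(I+\mathcal D(s)^{-1}s^2\mathcal Q(s)\bigr)^{-1}\mathcal D(s)^{-1}s^2B^{\mathrm{in}}(s)\in\mathbb C^{M\times M},$$ where $\mathcal A_b=-\operatorname{diag}(C_i(\varepsilon))$, $\mathcal D(s)=\operatorname{diag}(\omega_{M,i}^{-2}s^2+1)$, $\mathcal Q_{ij}(s)=C_j(\varepsilon)e^{-s\tau_{ij}}/(4\pi d_{ij})$ for $i\ne j$, $\mathcal Q_{ii}=0$, and $B^{\mathrm{in}}(s)$ is an entire $M\times M$ matrix-valued function (converting incident traces at the bubble centers to forcing).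 $H_b$ is meromorphic on $\mathbb C$. *)

theory Defs
  imports "HOL-Complex_Analysis.Complex_Analysis" "HOL-Probability.Essential_Supremum"
begin

definition diag_mat :: "('m \<Rightarrow> complex) \<Rightarrow> complex^'m^'m" where
  "diag_mat f = (\<chi> i j. if i = j then f i else 0)"

definition A_mat :: "('m \<Rightarrow> real) \<Rightarrow> real \<Rightarrow> complex^'m^'m" where
  "A_mat Ct eps = - diag_mat (\<lambda>i. of_real (eps * Ct i))"

definition D_mat :: "('m \<Rightarrow> real) \<Rightarrow> complex \<Rightarrow> complex^'m^'m" where
  "D_mat omega s = diag_mat (\<lambda>i. s\<^sup>2 / (of_real (omega i))\<^sup>2 + 1)"

definition Q_mat ::
  "('m \<Rightarrow> real) \<Rightarrow> real \<Rightarrow> ('m \<Rightarrow> real^3) \<Rightarrow> real \<Rightarrow> complex \<Rightarrow> complex^'m^'m" where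
  "Q_mat Ct c0 z eps s = (\<chi> i j.
     if i = j then 0
     else of_real (eps * Ct j) * exp (- s * of_real (dist (z i) (z j) / c0))
            / of_real (4 * pi * dist (z i) (z j)))"

definition transfer_formula ::
  "('m::finite \<Rightarrow> real) \<Rightarrow> ('m \<Rightarrow> real) \<Rightarrow> real \<Rightarrow> ('m \<Rightarrow> real^3) \<Rightarrow>
   (complex \<Rightarrow> complex^'m^'m) \<Rightarrow> real \<Rightarrow> complex \<Rightarrow> complex^'m^'m" where
  "transfer_formula omega Ct c0 z Bin eps s =
     A_mat Ct eps
     ** matrix_inv (mat 1 + matrix_inv (D_mat omega s) ** mat (s\<^sup>2) ** Q_mat Ct c0 z eps s)
     ** matrix_inv (D_mat omega s) ** mat (s\<^sup>2) ** Bin s"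

(* The formula above is meaningful only off the discrete set where one of the two inverted
   matrices is singular; in particular it breaks down at every i * omega_k, although the
   meromorphic function it represents need not have a pole there.  transfer_matrix is that
   meromorphic function: every entry takes its limit value at removable singularities. *)
definition transfer_matrix ::
  "('m::finite \<Rightarrow> real) \<Rightarrow> ('m \<Rightarrow> real) \<Rightarrow> real \<Rightarrow> ('m \<Rightarrow> real^3) \<Rightarrow>
   (complex \<Rightarrow> complex^'m^'m) \<Rightarrow> real \<Rightarrow> complex \<Rightarrow> complex^'m^'m" where
  "transfer_matrix omega Ct c0 z Bin eps s =
     (\<chi> i j. remove_sings (\<lambda>w. transfer_formula omega Ct c0 z Bin eps w $ i $ j) s)"

definition matrix_poles :: "(complex \<Rightarrow> complex^'m^'m) \<Rightarrow> complex set" where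
  "matrix_poles H = {s. \<exists>i j. is_pole (\<lambda>w. H w $ i $ j) s}"

(* Norm of the operator that A induces on C^m with its Euclidean norm. *)
definition op_norm :: "complex^'m^'m \<Rightarrow> real" where
  "op_norm A = onorm (\<lambda>v. A *v v)"

(* Extended-real valued, so that no boundedness has to be presupposed. *)
definition sup_norm_on :: "real set \<Rightarrow> (real \<Rightarrow> complex^'m^'m) \<Rightarrow> ereal" where
  "sup_norm_on J F = (SUP w\<in>J. ereal (op_norm (F w)))"

definition ess_sup_norm_on :: "real set \<Rightarrow> (real \<Rightarrow> complex^'m^'m) \<Rightarrow> ereal" where
  "ess_sup_norm_on J F = esssup (lebesgue_on J) (\<lambda>w. ereal (op_norm (F w)))"

definition measurable_right_inverse ::
  "real set \<Rightarrow> (real \<Rightarrow> complex^'m^'m) \<Rightarrow> (real \<Rightarrow> complex^'m^'m) \<Rightarrow> bool" where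
  "measurable_right_inverse J F R \<longleftrightarrow>
     R \<in> borel_measurable (lebesgue_on J) \<and> (\<forall>w\<in>J. F w ** R w = mat 1)"

end

theory Submission
  imports Defs
begin

text \<open>Multiplying through by \<open>D\<close>, the transfer matrix is \<open>-\<epsilon> diag(C) M\<inverse> s\<^sup>2 B\<close> with
  \<open>M = D + s\<^sup>2 Q\<close>, so by Cramer's rule its entries are \<open>\<epsilon>\<close> times a quotient of entire functions
  with denominator \<open>det M\<close>. The matrix \<open>M\<close> depends on \<open>\<epsilon>\<close> only through the distances
  \<open>d\<close> and the quotients \<open>\<epsilon> / d\<close>, which range over a compact set, and \<open>det M = 1\<close> at
  \<open>s = 0\<close>. By compactness there is one \<open>\<delta> > 0\<close> such that every point of \<open>iJ\<close> is the centre
  of a circle of radius less than \<open>d\<^sub>J\<close> on which \<open>\<bar>det M\<bar> \<ge> \<delta>\<close>. The transfer matrix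
  has no pole inside that circle, so the maximum principle carries the bound from the circle to
  its centre, uniformly in \<open>\<epsilon>\<close>.\<close>

no_notation fps_nth (infixl "$" 75)

section \<open>Operator norms and determinants of complex matrices\<close>

lemma norm_entry_le_op_norm: "cmod (A $ i $ j) \<le> op_norm A" for A :: "complex^'m::finite^'m"
proof -
  have "cmod (A $ i $ j) = cmod ((A *v axis j 1) $ i)"
    by (simp add: matrix_vector_mult_def axis_def if_distrib cong: if_cong)
  also have "\<dots> \<le> norm (A *v axis j 1)"
    by (rule Finite_Cartesian_Product.norm_nth_le)
  also have "\<dots> \<le> op_norm A * norm (axis j (1::complex))"
    unfolding op_norm_def by (rule onorm) simp
  finally show ?thesis by simp
qed

lemma op_norm_le_sum_entries:
  "op_norm A \<le> (\<Sum>i\<in>UNIV. \<Sum>j\<in>UNIV. cmod (A $ i $ j))" for A :: "complex^'m::finite^'m"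
  unfolding op_norm_def
proof (rule onorm_bound)
  fix x :: "complex^'m"
  have "norm (A *v x) \<le> (\<Sum>i\<in>UNIV. cmod ((A *v x) $ i))"
    by (simp add: norm_vec_def L2_set_le_sum)
  also have "\<dots> \<le> (\<Sum>i\<in>UNIV. \<Sum>j\<in>UNIV. cmod (A $ i $ j) * norm x)"
    unfolding matrix_vector_mult_def
    by (auto intro!: sum_mono order_trans[OF norm_sum] mult_left_mono
        simp: norm_mult Finite_Cartesian_Product.norm_nth_le)
  finally show "norm (A *v x) \<le> (\<Sum>i\<in>UNIV. \<Sum>j\<in>UNIV. cmod (A $ i $ j)) * norm x"
    by (simp add: sum_distrib_right)
qed (auto intro!: sum_nonneg)

text \<open>Apply \<open>A ** B\<close> to a unit vector. Every lower bound for a right inverse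
  rests on this inequality.\<close>

lemma one_le_op_norm_mult:
  fixes A B :: "complex^'m::finite^'m"
  assumes "A ** B = mat 1"
  shows "1 \<le> op_norm A * op_norm B"
proof -
  define e :: "complex^'m" where "e = axis undefined 1"
  have [simp]: "norm e = 1" by (simp add: e_def)
  have "1 = norm (A *v (B *v e))"
    by (simp add: matrix_vector_mul_assoc assms)
  also have "\<dots> \<le> op_norm A * norm (B *v e)"
    unfolding op_norm_def by (rule onorm) simp
  also have "norm (B *v e) \<le> op_norm B * norm e"
    unfolding op_norm_def by (rule onorm) simp
  then have "op_norm A * norm (B *v e) \<le> op_norm A * op_norm B"
    by (auto intro!: mult_left_mono simp: op_norm_def onorm_pos_le)
  finally show ?thesis .
qed

text \<open>By the Leibniz expansion: there are \<open>fact CARD('m)\<close> permutations, and signs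
  have modulus 1.\<close>

lemma norm_det_le:
  fixes A :: "complex^'m::finite^'m"
  assumes "\<And>i j. cmod (A $ i $ j) \<le> c"
  shows "cmod (det A) \<le> fact CARD('m) * c ^ CARD('m)"
proof -
  have "cmod (det A) \<le> (\<Sum>p | p permutes (UNIV::'m set). c ^ CARD('m))"
    unfolding det_def
  proof (intro sum_norm_le)
    fix p :: "'m \<Rightarrow> 'm"
    have "cmod (of_int (sign p)) = 1"
      by (simp add: sign_def)
    then show "cmod (of_int (sign p) * (\<Prod>i\<in>UNIV. A $ i $ p i)) \<le> c ^ CARD('m)"
      using prod_mono[of UNIV "\<lambda>i. cmod (A $ i $ p i)" "\<lambda>_. c"] assms
      by (simp add: norm_mult prod_norm)
  qed
  then show ?thesis
    by (simp add: card_permutations)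
qed

section \<open>Lower bounds on circles for families of entire functions\<close>

text \<open>The radius has to depend on \<open>u\<close> and \<open>s\<close>: it is chosen at the limit of a minimising
  sequence, where the zeros are isolated and some small circle avoids them.\<close>
lemma uniform_lower_bound_on_circles:
  fixes F :: "'a::metric_space \<Rightarrow> complex \<Rightarrow> complex"
  assumes "compact K" "compact S" "0 < d"
    and cont: "continuous_on UNIV (\<lambda>(u, s). F u s)"
    and hol: "\<And>u. F u holomorphic_on UNIV"
    and nz: "\<And>u. F u 0 \<noteq> 0"
  obtains \<delta> where "0 < \<delta>"
    "\<And>u s. u \<in> K \<Longrightarrow> s \<in> S \<Longrightarrow> \<exists>r. 0 < r \<and> r < d \<and> (\<forall>v\<in>sphere s r. \<delta> \<le> cmod (F u v))"
proof (rule ccontr)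
  assume no: "\<not> thesis"
  \<comment> \<open>Since \<open>inverse (real (Suc n))\<close> cannot serve as \<delta>, some pair
    violates it on every circle of radius less than \<open>d\<close>.\<close>
  have "\<exists>us. fst us \<in> K \<and> snd us \<in> S \<and> (\<forall>r. 0 < r \<longrightarrow> r < d \<longrightarrow>
      (\<exists>v\<in>sphere (snd us) r. cmod (F (fst us) v) < inverse (real (Suc n))))" for n
  proof (rule ccontr)
    assume *: "\<not> ?thesis"
    show False
    proof (rule no[THEN notE], rule that)
      show "0 < inverse (real (Suc n))" by simp
    next
      fix u s
      assume "u \<in> K" "s \<in> S"
      then have "\<not> (\<forall>r. 0 < r \<longrightarrow> r < d \<longrightarrow> (\<exists>v\<in>sphere s r. cmod (F u v) < inverse (real (Suc n))))"
        using *[unfolded not_ex, rule_format, of "(u, s)"] unfolding fst_conv snd_conv by blast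
      then show "\<exists>r. 0 < r \<and> r < d \<and> (\<forall>v\<in>sphere s r. inverse (real (Suc n)) \<le> cmod (F u v))"
        by (simp only: not_all not_imp not_le not_less Ball_def Bex_def not_ex de_Morgan_conj) blast
    qed
  qed
  then obtain us where usn: "\<And>n. fst (us n) \<in> K \<and> snd (us n) \<in> S \<and> (\<forall>r. 0 < r \<longrightarrow> r < d \<longrightarrow>
      (\<exists>v\<in>sphere (snd (us n)) r. cmod (F (fst (us n)) v) < inverse (real (Suc n))))"
    by (rule that[OF someI_ex])
  define u s where "u n = fst (us n)" and "s n = snd (us n)" for n
  have us: "u n \<in> K" "s n \<in> S" for n
    using usn[of n] by (auto simp: u_def s_def)
  have small: "\<exists>v\<in>sphere (s n) r. cmod (F (u n) v) < inverse (real (Suc n))"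
    if "0 < r" "r < d" for n r
    using usn[of n] that unfolding u_def s_def by blast
  have "seq_compact (K \<times> S)"
    using assms(1,2) by (simp add: compact_Times compact_imp_seq_compact)
  moreover have "\<forall>n. (u n, s n) \<in> K \<times> S"
    using us by simp
  ultimately obtain l \<sigma> where l: "l \<in> K \<times> S" and \<sigma>: "strict_mono \<sigma>"
    and "((\<lambda>n. (u n, s n)) \<circ> \<sigma>) \<longlonglongrightarrow> l"
    by (rule seq_compactE)
  then have lim: "(\<lambda>n. (u (\<sigma> n), s (\<sigma> n))) \<longlonglongrightarrow> l"
    by (simp add: o_def)
  obtain u0 s0 where [simp]: "l = (u0, s0)" by (cases l)
  have "\<forall>\<^sub>F w in at s0. F u0 w \<noteq> 0 \<and> w \<in> UNIV"
    by (rule non_zero_neighbour_alt[OF hol _ _ _ _ nz]) auto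
  then obtain e where e: "0 < e" "\<And>w. w \<noteq> s0 \<Longrightarrow> dist w s0 < e \<Longrightarrow> F u0 w \<noteq> 0"
    by (auto simp: eventually_at)
  \<comment> \<open>By \<open>nz\<close> the limit function \<open>F u0\<close> is not identically
    zero, so the punctured disc of radius \<open>e\<close> about \<open>s0\<close> is free of zeros.
    The circle of radius \<open>r\<close> lies in it, and \<open>r < d\<close> makes
    \<open>small\<close> applicable.\<close>
  define r where "r = min e d / 2"
  have r: "0 < r" "r < d" "r < e"
    using e(1) assms(3) by (auto simp: r_def)
  \<comment> \<open>Subtracting the moving centre puts the bad points on one fixed compact
    circle.\<close>
  have "\<exists>v. v \<in> sphere 0 r \<and> cmod (F (u n) (s n + v)) < inverse (real (Suc n))" for n
  proof -
    obtain w where "w \<in> sphere (s n) r" "cmod (F (u n) w) < inverse (real (Suc n))"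
      using small[OF r(1,2), of n] by blast
    then show ?thesis
      by (intro exI[of _ "w - s n"]) (auto simp: dist_norm norm_minus_commute)
  qed
  then obtain v where v: "\<And>n. v n \<in> sphere 0 r"
    and vs: "\<And>n. cmod (F (u n) (s n + v n)) < inverse (real (Suc n))"
    by metis
  have "seq_compact (sphere (0::complex) r)"
    by (simp add: compact_imp_seq_compact)
  moreover have "\<forall>n. (v \<circ> \<sigma>) n \<in> sphere 0 r"
    using v by simp
  ultimately obtain v0 \<rho> where v0: "v0 \<in> sphere 0 r" and \<rho>: "strict_mono \<rho>"
    and limv: "((v \<circ> \<sigma>) \<circ> \<rho>) \<longlonglongrightarrow> v0"
    by (rule seq_compactE)
  have lims: "(\<lambda>n. u (\<sigma> (\<rho> n))) \<longlonglongrightarrow> u0" "(\<lambda>n. s (\<sigma> (\<rho> n))) \<longlonglongrightarrow> s0"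
    using LIMSEQ_subseq_LIMSEQ[OF tendsto_fst[OF lim] \<rho>]
      LIMSEQ_subseq_LIMSEQ[OF tendsto_snd[OF lim] \<rho>]
    by (simp_all add: o_def)
  have "(\<lambda>n. (u (\<sigma> (\<rho> n)), s (\<sigma> (\<rho> n)) + v (\<sigma> (\<rho> n)))) \<longlonglongrightarrow> (u0, s0 + v0)"
    using limv by (intro tendsto_intros lims) (simp add: o_def)
  then have "(\<lambda>n. F (u (\<sigma> (\<rho> n))) (s (\<sigma> (\<rho> n)) + v (\<sigma> (\<rho> n)))) \<longlonglongrightarrow> F u0 (s0 + v0)"
    using continuous_on_tendsto_compose[OF cont] by fastforce
  moreover have "(\<lambda>n. F (u (\<sigma> (\<rho> n))) (s (\<sigma> (\<rho> n)) + v (\<sigma> (\<rho> n)))) \<longlonglongrightarrow> 0"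
  proof (rule Lim_null_comparison)
    show "\<forall>\<^sub>F n in sequentially. cmod (F (u (\<sigma> (\<rho> n))) (s (\<sigma> (\<rho> n)) + v (\<sigma> (\<rho> n))))
            \<le> inverse (real (Suc (\<sigma> (\<rho> n))))"
      by (intro always_eventually allI less_imp_le vs)
    show "(\<lambda>n. inverse (real (Suc (\<sigma> (\<rho> n))))) \<longlonglongrightarrow> 0"
      using LIMSEQ_subseq_LIMSEQ[OF LIMSEQ_inverse_real_of_nat strict_mono_o[OF \<sigma> \<rho>]]
      by (simp add: o_def)
  qed
  ultimately have "F u0 (s0 + v0) = 0"
    by (rule LIMSEQ_unique)
  \<comment> \<open>\<open>v0\<close> has modulus \<open>r\<close>, strictly between 0 and
    \<open>e\<close>, so the limit point lies in the zero-free punctured disc.\<close>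
  moreover have "F u0 (s0 + v0) \<noteq> 0"
    using e(2)[of "s0 + v0"] v0 r by (auto simp: dist_norm)
  ultimately show False by simp
qed

section \<open>The matrix D + s^2 Q and its determinant\<close>

text \<open>The matrix \<open>D + s\<^sup>2 Q\<close> as a function of \<open>u\<close>, which collects the quotients
  \<open>\<epsilon> / d\<^sub>i\<^sub>j\<close> and the distances \<open>d\<^sub>i\<^sub>j\<close>; these stay in a compact set as \<open>\<epsilon> \<rightarrow> 0\<close>
  because \<open>p < 1\<close>.\<close>
definition char_mat ::
  "('m::finite \<Rightarrow> real) \<Rightarrow> ('m \<Rightarrow> real) \<Rightarrow> real \<Rightarrow> (real^'m^'m) \<times> (real^'m^'m) \<Rightarrow> complex \<Rightarrow>
   complex^'m^'m" where
  "char_mat omega Ct c0 u s = (\<chi> i j.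
     if i = j then s\<^sup>2 / (of_real (omega i))\<^sup>2 + 1
     else s\<^sup>2 * (of_real (Ct j * fst u $ i $ j) * exp (- s * of_real (snd u $ i $ j / c0))
            / of_real (4 * pi)))"

definition geometry :: "('m::finite \<Rightarrow> real^3) \<Rightarrow> real \<Rightarrow> (real^'m^'m) \<times> (real^'m^'m)" where
  "geometry z eps = (\<chi> i j. eps / dist (z i) (z j), \<chi> i j. dist (z i) (z j))"

lemma holomorphic_on_det:
  fixes A :: "complex \<Rightarrow> complex^'m::finite^'m"
  assumes "\<And>i j. (\<lambda>s. A s $ i $ j) holomorphic_on T"
  shows "(\<lambda>s. det (A s)) holomorphic_on T"
  unfolding det_def by (intro holomorphic_intros assms)

lemma continuous_on_char_mat:
  "continuous_on T (\<lambda>(u, s). char_mat omega Ct c0 u s $ i $ j)"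
proof (cases "i = j")
  case True
  then show ?thesis
    by (simp add: char_mat_def case_prod_beta divide_inverse)
      (intro continuous_on_add continuous_on_mult continuous_on_const continuous_on_power
        continuous_on_snd continuous_on_id)
next
  case False
  then have eq: "(\<lambda>(u, s). char_mat omega Ct c0 u s $ i $ j) =
      (\<lambda>p. (snd p)\<^sup>2 * (of_real (Ct j * fst (fst p) $ i $ j)
      * exp (- snd p * of_real (snd (fst p) $ i $ j / c0)) / of_real (4 * pi)))"
    by (simp add: char_mat_def fun_eq_iff)
  show ?thesis
    unfolding eq divide_inverse
    by (intro continuous_on_mult continuous_on_const continuous_on_power continuous_on_minus
        continuous_on_exp continuous_on_of_real continuous_on_component
        continuous_on_snd continuous_on_fst continuous_on_id)
qed

lemma continuous_on_det_char_mat: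
  "continuous_on T (\<lambda>(u, s). det (char_mat omega Ct c0 u s))"
  using continuous_on_char_mat[of T omega Ct c0] unfolding det_def case_prod_beta
  by (intro continuous_on_sum continuous_on_mult continuous_on_const continuous_on_prod) auto

lemma holomorphic_char_mat:
  "(\<lambda>s. char_mat omega Ct c0 u s $ i $ j) holomorphic_on T"
proof (cases "i = j")
  case True
  then show ?thesis
    by (simp add: char_mat_def divide_inverse) (intro holomorphic_intros)
next
  case False
  then have eq: "(\<lambda>s. char_mat omega Ct c0 u s $ i $ j) = (\<lambda>s. s\<^sup>2 * (of_real (Ct j * fst u $ i $ j)
      * exp (- s * of_real (snd u $ i $ j / c0)) / of_real (4 * pi)))"
    by (simp add: char_mat_def)
  show ?thesis
    unfolding eq by (intro holomorphic_intros) simp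
qed

text \<open>This holds for every \<open>u\<close>, even one that no configuration realises, so no
  determinant of the family vanishes identically.\<close>

lemma det_char_mat_0: "det (char_mat omega Ct c0 u 0) = 1"
proof -
  have "char_mat omega Ct c0 u 0 = mat 1"
    by (simp add: char_mat_def mat_def vec_eq_iff)
  then show ?thesis by simp
qed

section \<open>Cramer's rule for the transfer matrix\<close>

lemma mat_mult_entry: "(mat c ** A) $ i $ j = c * A $ i $ j" for A :: "complex^'m::finite^'m"
  by (simp add: matrix_matrix_mult_def mat_def if_distrib[where f = "\<lambda>x. x * _"] cong: if_cong)

lemma diag_mat_mult_entry: "(diag_mat f ** A) $ i $ j = f i * A $ i $ j"
  for A :: "complex^'m::finite^'m"
  by (simp add: matrix_matrix_mult_def diag_mat_def if_distrib[where f = "\<lambda>x. x * _"] cong: if_cong)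

text \<open>Reading \<open>eps * Ct j / d\<close> as \<open>Ct j * (eps / d)\<close> absorbs the
  singular factor 1 / d into a bounded parameter.\<close>

lemma char_mat_geometry:
  "char_mat omega Ct c0 (geometry z eps) s = D_mat omega s + mat (s\<^sup>2) ** Q_mat Ct c0 z eps s"
  by (simp add: vec_eq_iff mat_mult_entry char_mat_def geometry_def D_mat_def diag_mat_def Q_mat_def mult_ac)

lemma mult_matrix_inv_of_det_nonzero:
  "det A \<noteq> 0 \<Longrightarrow> A ** matrix_inv A = mat 1" for A :: "complex^'m::finite^'m"
  unfolding matrix_inv_def
  using someI_ex[of "\<lambda>A'. A ** A' = mat 1 \<and> A' ** A = mat 1"]
  by (simp add: invertible_det_nz[symmetric] invertible_def)


text \<open>The numerator matrix of Cramer's rule for the entry (i, j) of the solution of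
  \<open>M ** X = Y\<close>.\<close>

definition cramer_mat :: "complex^'m^'m \<Rightarrow> complex^'m^'m \<Rightarrow> 'm \<Rightarrow> 'm \<Rightarrow> complex^'m::finite^'m" where
  "cramer_mat M Y i j = (\<chi> k l. if l = i then Y $ k $ j else M $ k $ l)"

lemma cramer_matrix_equation:
  fixes M X Y :: "complex^'m::finite^'m"
  assumes "det M \<noteq> 0" "M ** X = Y"
  shows "X $ i $ j = det (cramer_mat M Y i j) / det M"
proof -
  have "M *v (\<chi> k. X $ k $ j) = (\<chi> k. Y $ k $ j)"
    using assms(2) by (auto simp: vec_eq_iff matrix_vector_mult_def matrix_matrix_mult_def)
  then have "(\<chi> k. X $ k $ j)
      = (\<chi> i. det (\<chi> k l. if l = i then (\<chi> k. Y $ k $ j) $ k else M $ k $ l) / det M)"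
    by (rule cramer[OF assms(1), THEN iffD1])
  then show ?thesis
    by (simp add: vec_eq_iff cramer_mat_def cong: if_cong)
qed

text \<open>The transfer entry after clearing D: a zero of \<open>det (D_mat omega s)\<close> alone
  is no longer a singularity.\<close>

definition transfer_quotient ::
  "('m::finite \<Rightarrow> real) \<Rightarrow> ('m \<Rightarrow> real) \<Rightarrow> real \<Rightarrow> ('m \<Rightarrow> real^3) \<Rightarrow>
   (complex \<Rightarrow> complex^'m^'m) \<Rightarrow> real \<Rightarrow> 'm \<Rightarrow> 'm \<Rightarrow> complex \<Rightarrow> complex" where
  "transfer_quotient omega Ct c0 z Bin eps i j s = - of_real (eps * Ct i) *
     (det (cramer_mat (char_mat omega Ct c0 (geometry z eps) s) (mat (s\<^sup>2) ** Bin s) i j)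
      / det (char_mat omega Ct c0 (geometry z eps) s))"

text \<open>With P the first matrix inverted in the formula, D P = M. Hence P is invertible, and
  P^-1 D^-1 s^2 B solves M X = s^2 B, where Cramer's rule applies.\<close>

lemma transfer_formula_entry:
  assumes D: "det (D_mat omega s) \<noteq> 0" and M: "det (char_mat omega Ct c0 (geometry z eps) s) \<noteq> 0"
  shows "transfer_formula omega Ct c0 z Bin eps s $ i $ j
    = transfer_quotient omega Ct c0 z Bin eps i j s"
proof -
  let ?D = "D_mat omega s" and ?Q = "Q_mat Ct c0 z eps s"
    and ?M = "char_mat omega Ct c0 (geometry z eps) s"
  let ?P = "mat 1 + matrix_inv ?D ** mat (s\<^sup>2) ** ?Q"
  let ?X = "matrix_inv ?P ** matrix_inv ?D ** mat (s\<^sup>2) ** Bin s"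
  have "?D ** ?P = ?D + (?D ** matrix_inv ?D) ** mat (s\<^sup>2) ** ?Q"
    by (simp add: matrix_add_ldistrib matrix_mul_assoc)
  then have DP: "?D ** ?P = ?M"
    by (simp add: mult_matrix_inv_of_det_nonzero[OF D] char_mat_geometry)
  then have P: "det ?P \<noteq> 0"
    using M by (metis det_mul mult_zero_right)
  have "?M ** ?X = (?D ** (?P ** matrix_inv ?P)) ** matrix_inv ?D ** mat (s\<^sup>2) ** Bin s"
    unfolding DP[symmetric] by (simp only: matrix_mul_assoc)
  then have "?M ** ?X = mat (s\<^sup>2) ** Bin s"
    by (simp only: mult_matrix_inv_of_det_nonzero[OF P] mult_matrix_inv_of_det_nonzero[OF D] matrix_mul_rid matrix_mul_lid)
  then have "?X $ i $ j = det (cramer_mat ?M (mat (s\<^sup>2) ** Bin s) i j) / det ?M"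
    by (rule cramer_matrix_equation[OF M])
  moreover have "transfer_formula omega Ct c0 z Bin eps s = A_mat Ct eps ** ?X"
    by (simp only: transfer_formula_def matrix_mul_assoc)
  moreover have "A_mat Ct eps = diag_mat (\<lambda>i. - of_real (eps * Ct i))"
    by (simp add: A_mat_def diag_mat_def vec_eq_iff)
  ultimately show ?thesis
    by (simp only: diag_mat_mult_entry transfer_quotient_def)
qed

text \<open>The determinant is entire and nonzero at 0, so by the identity theorem its zeros are
  isolated.\<close>

lemma eventually_det_nonzero:
  fixes A :: "complex \<Rightarrow> complex^'m::finite^'m"
  assumes "\<And>i j. (\<lambda>s. A s $ i $ j) holomorphic_on UNIV" "det (A 0) \<noteq> 0"
  shows "\<forall>\<^sub>F w in at s. det (A w) \<noteq> 0"
  using non_zero_neighbour_alt[OF holomorphic_on_det[OF assms(1)] open_UNIV connected_UNIV UNIV_I UNIV_I, of 0 s]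
    assms(2) by simp

text \<open>Formula and quotient agree on a punctured neighbourhood of every point, also where D or
  M is singular, and \<open>remove_sings\<close> sees only the values there.\<close>

lemma transfer_matrix_entry:
  "transfer_matrix omega Ct c0 z Bin eps s $ i $ j
    = remove_sings (transfer_quotient omega Ct c0 z Bin eps i j) s"
proof -
  have "D_mat omega 0 = mat 1"
    by (simp add: D_mat_def diag_mat_def mat_def vec_eq_iff)
  moreover have "(\<lambda>s. D_mat omega s $ i $ j) holomorphic_on UNIV" for i j
    unfolding D_mat_def diag_mat_def divide_inverse
    by (cases "i = j") (simp_all, intro holomorphic_intros)
  ultimately have "\<forall>\<^sub>F w in at s. det (D_mat omega w) \<noteq> 0"
    by (intro eventually_det_nonzero) simp_all
  moreover have "\<forall>\<^sub>F w in at s. det (char_mat omega Ct c0 (geometry z eps) w) \<noteq> 0"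
    by (intro eventually_det_nonzero holomorphic_char_mat) (simp add: det_char_mat_0)
  ultimately have "\<forall>\<^sub>F w in at s. transfer_formula omega Ct c0 z Bin eps w $ i $ j
      = transfer_quotient omega Ct c0 z Bin eps i j w"
    by eventually_elim (rule transfer_formula_entry)
  then show ?thesis
    unfolding transfer_matrix_def by (simp add: remove_sings_cong)
qed

section \<open>The maximum principle for one entry\<close>

lemma holomorphic_det_cramer_mat:
  fixes Bin :: "complex \<Rightarrow> complex^'m::finite^'m"
  assumes "\<And>i j. (\<lambda>s. Bin s $ i $ j) holomorphic_on UNIV"
  shows "(\<lambda>s. det (cramer_mat (char_mat omega Ct c0 u s) (mat (s\<^sup>2) ** Bin s) i j)) holomorphic_on UNIV"
proof (rule holomorphic_on_det)
  fix k l
  have "(\<lambda>s. s\<^sup>2 * Bin s $ k $ j) holomorphic_on UNIV"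
    by (intro holomorphic_intros assms)
  then show "(\<lambda>s. cramer_mat (char_mat omega Ct c0 u s) (mat (s\<^sup>2) ** Bin s) i j $ k $ l) holomorphic_on UNIV"
    by (cases "l = i") (simp_all add: cramer_mat_def mat_mult_entry holomorphic_char_mat)
qed

text \<open>The determinant may vanish inside the disc: absence of poles still makes the entry
  analytic there, and the quotient is estimated on the circle alone.\<close>

lemma transfer_matrix_entry_bound:
  fixes Bin :: "complex \<Rightarrow> complex^'m::finite^'m"
  assumes hol: "\<And>i j. (\<lambda>s. Bin s $ i $ j) holomorphic_on UNIV"
    and no_pole: "\<And>s. s \<in> cball s0 r \<Longrightarrow> s \<notin> matrix_poles (transfer_matrix omega Ct c0 z Bin eps)"
    and "0 < r" "0 < \<delta>" "0 \<le> eps" "0 \<le> Ct i"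
    and den: "\<And>s. s \<in> sphere s0 r \<Longrightarrow> \<delta> \<le> cmod (det (char_mat omega Ct c0 (geometry z eps) s))"
    and num: "\<And>s. s \<in> sphere s0 r \<Longrightarrow>
      cmod (det (cramer_mat (char_mat omega Ct c0 (geometry z eps) s) (mat (s\<^sup>2) ** Bin s) i j)) \<le> B"
  shows "cmod (transfer_matrix omega Ct c0 z Bin eps s0 $ i $ j) \<le> eps * Ct i * (B / \<delta>)"
proof -
  let ?q = "transfer_quotient omega Ct c0 z Bin eps i j"
  let ?h = "remove_sings ?q"
  have num_an: "(\<lambda>s. det (cramer_mat (char_mat omega Ct c0 (geometry z eps) s) (mat (s\<^sup>2) ** Bin s) i j))
      analytic_on UNIV"
    using holomorphic_det_cramer_mat[OF hol] by (simp add: analytic_on_open)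
  have den_an: "(\<lambda>s. det (char_mat omega Ct c0 (geometry z eps) s)) analytic_on UNIV"
    using holomorphic_on_det[OF holomorphic_char_mat] by (simp add: analytic_on_open)
  have "?q meromorphic_on UNIV"
    unfolding transfer_quotient_def
    by (intro meromorphic_intros analytic_on_imp_meromorphic_on num_an den_an)
  then have nice: "?h nicely_meromorphic_on UNIV"
    by (rule remove_sings_nicely_meromorphic)
  \<comment> \<open>After \<open>remove_sings\<close> a meromorphic function is analytic at every
    point that is not a pole.\<close>
  have "\<not> is_pole ?h s" if "s \<in> cball s0 r" for s
    using no_pole[OF that] by (auto simp: matrix_poles_def transfer_matrix_entry)
  then have "?h analytic_on {s}" if "s \<in> cball s0 r" for s
    using nicely_meromorphic_on_imp_analytic_at[OF nice] that by blast
  then have an: "?h analytic_on cball s0 r"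
    using analytic_on_analytic_at by blast
  have "cmod (?h s0) \<le> eps * Ct i * (B / \<delta>)"
  proof (rule maximum_modulus_frontier[of ?h "cball s0 r"])
    show "?h holomorphic_on interior (cball s0 r)"
      using an interior_subset by (metis analytic_imp_holomorphic holomorphic_on_subset)
    show "continuous_on (closure (cball s0 r)) ?h"
      using an by (simp add: analytic_imp_holomorphic holomorphic_on_imp_continuous_on)
    fix s assume "s \<in> frontier (cball s0 r)"
    then have s: "s \<in> sphere s0 r"
      using \<open>0 < r\<close> by (simp add: frontier_cball)
    let ?N = "det (cramer_mat (char_mat omega Ct c0 (geometry z eps) s) (mat (s\<^sup>2) ** Bin s) i j)"
      and ?d = "det (char_mat omega Ct c0 (geometry z eps) s)"
    have d: "?d \<noteq> 0"
      using den[OF s] \<open>0 < \<delta>\<close> by auto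
    \<comment> \<open>The denominator does not vanish on the circle, so \<open>remove_sings\<close>
      leaves the quotient unchanged there.\<close>
    have "?q analytic_on {s}"
      unfolding transfer_quotient_def using d
      by (intro analytic_intros analytic_on_subset[OF num_an] analytic_on_subset[OF den_an]) auto
    then have "?h s = ?q s"
      by (rule remove_sings_at_analytic)
    then have "cmod (?h s) = eps * Ct i * (cmod ?N / cmod ?d)"
      using \<open>0 \<le> eps\<close> \<open>0 \<le> Ct i\<close>
      by (simp add: transfer_quotient_def norm_mult norm_divide)
    also have "\<dots> \<le> eps * Ct i * (B / \<delta>)"
      using den[OF s] num[OF s] \<open>0 < \<delta>\<close> \<open>0 \<le> eps\<close> \<open>0 \<le> Ct i\<close>
      by (intro mult_left_mono frac_le) (auto intro: order_trans[OF norm_ge_zero])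
    finally show "cmod (?h s) \<le> eps * Ct i * (B / \<delta>)" .
  qed (use \<open>0 < r\<close> in auto)
  then show ?thesis
    by (simp add: transfer_matrix_entry)
qed

section \<open>Size of the geometry parameters and lower bounds for right inverses\<close>

lemma norm_geometry_le:
  fixes z :: "'m::finite \<Rightarrow> real^3" and eps \<beta> \<gamma> :: real
  assumes "\<And>i j. i \<noteq> j \<Longrightarrow> eps / dist (z i) (z j) \<le> \<beta>" "\<And>i j. i \<noteq> j \<Longrightarrow> dist (z i) (z j) \<le> \<gamma>"
    and "0 \<le> eps" "0 \<le> \<beta>" "0 \<le> \<gamma>"
  shows "norm (geometry z eps) \<le> (CARD('m))\<^sup>2 * (\<beta> + \<gamma>)"
proof -
  have *: "norm A \<le> (CARD('m))\<^sup>2 * c" if "\<And>i j. \<bar>A $ i $ j\<bar> \<le> c" for A :: "real^'m^'m" and c :: real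
  proof -
    have "norm A \<le> (\<Sum>i\<in>UNIV. norm (A $ i))"
      by (simp add: norm_vec_def L2_set_le_sum)
    also have "\<dots> \<le> (\<Sum>i\<in>UNIV. \<Sum>j\<in>UNIV. \<bar>A $ i $ j\<bar>)"
      by (intro sum_mono) (rule norm_le_l1_cart)
    also have "\<dots> \<le> (\<Sum>i\<in>(UNIV::'m set). \<Sum>j\<in>(UNIV::'m set). c)"
      by (intro sum_mono that)
    finally show ?thesis
      by (simp add: power2_eq_square)
  qed
  have "norm (geometry z eps) \<le> norm (fst (geometry z eps)) + norm (snd (geometry z eps))"
    by (metis norm_Pair_le prod.collapse)
  also have "\<dots> \<le> (CARD('m))\<^sup>2 * \<beta> + (CARD('m))\<^sup>2 * \<gamma>"
  proof (intro add_mono *)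
    fix i j :: 'm
    show "\<bar>fst (geometry z eps) $ i $ j\<bar> \<le> \<beta>" "\<bar>snd (geometry z eps) $ i $ j\<bar> \<le> \<gamma>"
      \<comment> \<open>Diagonal entries are 0, the first one by the convention for division by
        zero.\<close>
      using assms by (cases "i = j"; simp add: geometry_def)+
  qed
  finally show ?thesis by (simp add: distrib_left)
qed


text \<open>A right inverse at \<open>a\<close> forces \<open>op_norm (F a) > 0\<close>, so the
  supremum, bounded by \<open>c\<close>, is a positive real and has an ordinary reciprocal. Each
  \<open>op_norm (R w)\<close> is at least this reciprocal.\<close>

lemma right_inverse_ess_sup_bounds:
  fixes F R :: "real \<Rightarrow> complex^'m::finite^'m"
  assumes "a < b" and R: "measurable_right_inverse {a..b} F R"
    and le: "\<And>w. w \<in> {a..b} \<Longrightarrow> op_norm (F w) \<le> c"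
  shows "1 / sup_norm_on {a..b} F \<le> ess_sup_norm_on {a..b} R"
    and "ereal (1 / c) \<le> 1 / sup_norm_on {a..b} F"
proof -
  have a: "a \<in> {a..b}" using \<open>a < b\<close> by simp
  have one_le: "1 \<le> op_norm (F w) * op_norm (R w)" if "w \<in> {a..b}" for w
    using R that by (intro one_le_op_norm_mult) (auto simp: measurable_right_inverse_def)
  have nonneg: "0 \<le> op_norm A" for A :: "complex^'m^'m"
    by (simp add: op_norm_def onorm_pos_le)
  have pos: "0 < op_norm (F a)"
    using one_le[OF a] nonneg[of "F a"] by (cases "op_norm (F a) = 0") auto
  let ?s = "sup_norm_on {a..b} F"
  have upper: "?s \<le> ereal c"
    unfolding sup_norm_on_def by (intro SUP_least) (simp add: le)
  have F_le: "ereal (op_norm (F w)) \<le> ?s" if "w \<in> {a..b}" for w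
    unfolding sup_norm_on_def using that by (rule SUP_upper)
  obtain \<sigma> where \<sigma>: "?s = ereal \<sigma>"
    using upper F_le[OF a] by (cases ?s) auto
  have \<sigma>_pos: "0 < \<sigma>" and \<sigma>_le: "\<sigma> \<le> c"
    using F_le[OF a] pos upper by (auto simp: \<sigma>)
  have inv: "1 / ?s = ereal (1 / \<sigma>)"
    using \<sigma>_pos by (simp add: \<sigma> one_ereal_def)
  show "ereal (1 / c) \<le> 1 / ?s"
    using \<sigma>_pos \<sigma>_le by (simp add: inv frac_le)
  have R_ge: "1 / \<sigma> \<le> op_norm (R w)" if "w \<in> {a..b}" for w
  proof -
    have "1 \<le> \<sigma> * op_norm (R w)"
      using one_le[OF that] mult_right_mono[OF _ nonneg[of "R w"], of "op_norm (F w)" \<sigma>] F_le[OF that]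
      by (simp add: \<sigma>)
    then show ?thesis
      using \<sigma>_pos by (simp add: divide_le_eq mult.commute)
  qed
  have "AE w in lebesgue_on {a..b}. ereal (1 / \<sigma>) \<le> ess_sup_norm_on {a..b} R"
    using esssup_AE[of "\<lambda>w. ereal (op_norm (R w))" "lebesgue_on {a..b}"] AE_space
  proof eventually_elim
    case (elim w)
    then have "ereal (1 / \<sigma>) \<le> ereal (op_norm (R w))"
      using R_ge by simp
    with elim(1) show ?case
      unfolding ess_sup_norm_on_def by (rule order_trans[rotated])
  qed
  \<comment> \<open>Here \<open>a < b\<close> matters: the inequality just obtained does not mention
    \<open>w\<close>, and a constant statement that holds almost everywhere on a set of positive
    measure is true.\<close>
  moreover have "ae_filter (lebesgue_on {a..b}) \<noteq> bot"
    using \<open>a < b\<close> by (simp add: ae_filter_eq_bot_iff emeasure_restrict_space)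
  ultimately show "1 / ?s \<le> ess_sup_norm_on {a..b} R"
    by (simp add: inv eventually_const)
qed

section \<open>Uniform bound and divergence for the bubble clusters\<close>

theorem proposition6p1:
  fixes p c0 c1 c2 Dmin Dmax eps0 a b dJ :: real
    and N :: nat
    and I :: "nat \<Rightarrow> 'm::finite set"
    and omega Ct :: "'m \<Rightarrow> real"
    and omega_cl :: "nat \<Rightarrow> real"
    and z :: "real \<Rightarrow> 'm \<Rightarrow> real^3"
    and Bin :: "real \<Rightarrow> complex \<Rightarrow> complex^'m^'m"
    and H :: "real \<Rightarrow> complex \<Rightarrow> complex^'m^'m"
  assumes "0 < p" "p < 1" "0 < c0" "0 < eps0"
    and "0 < c1" "0 < c2" "0 < Dmin" "0 < Dmax"
    and "disjoint_family_on I {1..N}" "(\<Union>\<alpha>\<in>{1..N}. I \<alpha>) = UNIV"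
    and "\<And>i. 0 < omega i"
    and "\<And>\<alpha> i. \<alpha> \<in> {1..N} \<Longrightarrow> i \<in> I \<alpha> \<Longrightarrow> omega i = omega_cl \<alpha>"
    and "inj_on omega_cl {1..N}"
    and "\<And>i. 0 < Ct i"
    and "\<And>eps \<alpha> i j. eps \<in> {0<..<eps0} \<Longrightarrow> \<alpha> \<in> {1..N} \<Longrightarrow> i \<in> I \<alpha> \<Longrightarrow> j \<in> I \<alpha> \<Longrightarrow> i \<noteq> j \<Longrightarrow>
           dist (z eps i) (z eps j) \<in> {c1 * eps powr p .. c2 * eps powr p}"
    and "\<And>eps \<alpha> \<beta> i j. eps \<in> {0<..<eps0} \<Longrightarrow> \<alpha> \<in> {1..N} \<Longrightarrow> \<beta> \<in> {1..N} \<Longrightarrow> \<alpha> \<noteq> \<beta> \<Longrightarrow>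
           i \<in> I \<alpha> \<Longrightarrow> j \<in> I \<beta> \<Longrightarrow> dist (z eps i) (z eps j) \<in> {Dmin..Dmax}"
    and "\<And>eps i j. eps \<in> {0<..<eps0} \<Longrightarrow> (\<lambda>s. Bin eps s $ i $ j) holomorphic_on UNIV"
    (* automatic if Bin does not depend on eps *)
    and "\<And>K. compact K \<Longrightarrow> \<exists>c. \<forall>eps\<in>{0<..<eps0}. \<forall>s\<in>K. op_norm (Bin eps s) \<le> c"
    and "H = (\<lambda>eps. transfer_matrix omega Ct c0 (z eps) (Bin eps) eps)"
    and "0 < a" "a < b"
    and "dJ = Inf {cmod (\<i> * of_real w - s) | eps w s.
                     eps \<in> {0<..<eps0} \<and> w \<in> {a..b} \<and> s \<in> matrix_poles (H eps)}"
    and "0 < dJ"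
  shows "\<exists>CJ>0.
    (\<forall>eps\<in>{0<..<eps0}.
       sup_norm_on {a..b} (\<lambda>w. H eps (\<i> * of_real w)) \<le> ereal (eps * (CJ / dJ))) \<and>
    (\<forall>eps\<in>{0<..<eps0}. \<forall>R.
       measurable_right_inverse {a..b} (\<lambda>w. H eps (\<i> * of_real w)) R \<longrightarrow>
         ess_sup_norm_on {a..b} R \<ge> 1 / sup_norm_on {a..b} (\<lambda>w. H eps (\<i> * of_real w)) \<and>
         1 / sup_norm_on {a..b} (\<lambda>w. H eps (\<i> * of_real w)) \<ge> ereal (dJ / (eps * CJ))) \<and>
    (\<forall>R. (\<forall>\<^sub>F eps in at_right 0.
            measurable_right_inverse {a..b} (\<lambda>w. H eps (\<i> * of_real w)) (R eps)) \<longrightarrow>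
       ((\<lambda>eps. ess_sup_norm_on {a..b} (R eps)) \<longlongrightarrow> \<infinity>) (at_right 0))"
proof -
  note nearby = assms(15) and apart = assms(16)
  define S where "S = (\<lambda>w. \<i> * of_real w) ` {a..b}"
  have "compact S"
    unfolding S_def by (intro compact_continuous_image continuous_intros) simp
  \<comment> \<open>Within a cluster \<open>eps / d\<close> is at most
    \<open>eps powr (1 - p) / c1\<close>, which increases with \<open>eps\<close> because
    \<open>p < 1\<close>; across clusters it is at most \<open>eps0 / Dmin\<close>. The two entries
    of \<gamma> bound the distances in the same two cases.\<close>
  define \<beta> where "\<beta> = max (eps0 powr (1 - p) / c1) (eps0 / Dmin)"
  define \<gamma> where "\<gamma> = max (c2 * eps0 powr p) Dmax"
  define \<rho> where "\<rho> = (CARD('m))\<^sup>2 * (\<beta> + \<gamma>)"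
  have geometry_in: "geometry (z eps) eps \<in> cball 0 \<rho>" if eps: "eps \<in> {0<..<eps0}" for eps
  proof -
    have d: "eps / dist (z eps i) (z eps j) \<le> \<beta> \<and> dist (z eps i) (z eps j) \<le> \<gamma>" if "i \<noteq> j" for i j
    proof -
      obtain \<mu> \<nu> where \<mu>: "\<mu> \<in> {1..N}" "i \<in> I \<mu>" and \<nu>: "\<nu> \<in> {1..N}" "j \<in> I \<nu>"
        using \<open>(\<Union>\<alpha>\<in>{1..N}. I \<alpha>) = UNIV\<close> by (metis UNIV_I UN_E)
      show ?thesis
      proof (cases "\<mu> = \<nu>")
        case True
        have lo: "c1 * eps powr p \<le> dist (z eps i) (z eps j)"
          and hi: "dist (z eps i) (z eps j) \<le> c2 * eps powr p"
          using nearby[OF eps \<mu>(1) \<mu>(2) _ \<open>i \<noteq> j\<close>] \<nu>(2) True by auto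
        have "eps / dist (z eps i) (z eps j) \<le> eps / (c1 * eps powr p)"
          using lo eps \<open>0 < c1\<close> by (intro frac_le mult_pos_pos) auto
        also have "\<dots> = eps powr (1 - p) / c1"
          using eps by (simp add: powr_diff)
        also have "\<dots> \<le> eps0 powr (1 - p) / c1"
          using eps \<open>p < 1\<close> \<open>0 < c1\<close> by (intro divide_right_mono powr_mono2) auto
        finally have "eps / dist (z eps i) (z eps j) \<le> \<beta>"
          by (simp add: \<beta>_def)
        moreover have "c2 * eps powr p \<le> c2 * eps0 powr p"
          using eps \<open>0 < p\<close> \<open>0 < c2\<close> by (intro mult_left_mono powr_mono2) auto
        ultimately show ?thesis
          using hi by (simp add: \<gamma>_def)
      next
        case False
        have lo: "Dmin \<le> dist (z eps i) (z eps j)" and hi: "dist (z eps i) (z eps j) \<le> Dmax"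
          using apart[OF eps \<mu>(1) \<nu>(1) False \<mu>(2) \<nu>(2)] by auto
        have "eps / dist (z eps i) (z eps j) \<le> eps0 / Dmin"
          using lo eps \<open>0 < Dmin\<close> by (intro frac_le) auto
        then show ?thesis
          using hi by (auto simp: \<beta>_def \<gamma>_def le_max_iff_disj)
      qed
    qed
    have "0 \<le> \<beta>" "0 \<le> \<gamma>"
      using \<open>0 < Dmin\<close> \<open>0 < eps0\<close> \<open>0 < Dmax\<close> by (auto simp: \<beta>_def \<gamma>_def le_max_iff_disj)
    then have "norm (geometry (z eps) eps) \<le> \<rho>"
      unfolding \<rho>_def using d eps by (intro norm_geometry_le) auto
    then show ?thesis by simp
  qed
  \<comment> \<open>A full ball is compact, whereas nothing makes the set of realised geometries
    closed.\<close>
  define K where "K = cball (0 :: (real^'m^'m) \<times> (real^'m^'m)) \<rho>"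
  have "compact K"
    unfolding K_def by (rule compact_cball)
  \<comment> \<open>Radii below \<open>dJ\<close> will keep the closed discs free of poles, for
    every \<open>eps\<close> at once.\<close>
  obtain \<delta> where "0 < \<delta>" and circle: "\<And>u s. u \<in> K \<Longrightarrow> s \<in> S \<Longrightarrow>
      \<exists>r. 0 < r \<and> r < dJ \<and> (\<forall>v\<in>sphere s r. \<delta> \<le> cmod (det (char_mat omega Ct c0 u v)))"
    by (rule uniform_lower_bound_on_circles[OF \<open>compact K\<close> \<open>compact S\<close> \<open>0 < dJ\<close>
          continuous_on_det_char_mat holomorphic_on_det[OF holomorphic_char_mat]])
      (auto simp: det_char_mat_0)
  \<comment> \<open>Contains every circle that can occur: the centre has modulus at most
    \<open>b\<close>, the radius is less than \<open>dJ\<close>.\<close>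
  define T where "T = cball (0::complex) (b + dJ)"
  have "compact T"
    unfolding T_def by (rule compact_cball)
  obtain c where c: "\<And>u s k l. u \<in> K \<Longrightarrow> s \<in> T \<Longrightarrow> cmod (char_mat omega Ct c0 u s $ k $ l) \<le> c"
  proof -
    \<comment> \<open>One continuous function that dominates all entries, so that one constant
      serves every index.\<close>
    let ?f = "\<lambda>(u, s). \<Sum>k\<in>UNIV. \<Sum>l\<in>UNIV. cmod (char_mat omega Ct c0 u s $ k $ l)"
    have "continuous_on (K \<times> T) ?f"
      using continuous_on_char_mat[of "K \<times> T" omega Ct c0] unfolding case_prod_beta
      by (intro continuous_on_sum continuous_on_norm)
    then have "bounded (?f ` (K \<times> T))"
      using \<open>compact K\<close> \<open>compact T\<close>
      by (intro compact_imp_bounded compact_continuous_image compact_Times)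
    then obtain c where c: "\<And>x. x \<in> ?f ` (K \<times> T) \<Longrightarrow> norm x \<le> c"
      unfolding bounded_iff by blast
    have "cmod (char_mat omega Ct c0 u s $ k $ l) \<le> c" if "u \<in> K" "s \<in> T" for u s k l
    proof -
      have "cmod (char_mat omega Ct c0 u s $ k $ l) \<le> (\<Sum>l\<in>UNIV. cmod (char_mat omega Ct c0 u s $ k $ l))"
        by (rule member_le_sum) auto
      also have "\<dots> \<le> (\<Sum>k\<in>UNIV. \<Sum>l\<in>UNIV. cmod (char_mat omega Ct c0 u s $ k $ l))"
        by (rule member_le_sum) (auto intro: sum_nonneg)
      also have "\<dots> \<le> norm (?f (u, s))"
        by simp
      also have "\<dots> \<le> c"
        using that by (intro c imageI) auto
      finally show ?thesis .
    qed
    then show thesis by (rule that)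
  qed
  obtain cB where cB: "\<And>eps s. eps \<in> {0<..<eps0} \<Longrightarrow> s \<in> T \<Longrightarrow> op_norm (Bin eps s) \<le> cB"
    using assms(18)[OF \<open>compact T\<close>] by blast
  \<comment> \<open>Covers both kinds of columns in the Cramer numerator: those kept from
    \<open>char_mat\<close> and the one replaced by a column of s^2 \<open>Bin\<close>.\<close>
  define c' where "c' = max c ((b + dJ)\<^sup>2 * cB)"
  define B where "B = fact CARD('m) * c' ^ CARD('m)"
  \<comment> \<open>The \<open>max 1\<close> secures positivity. All ingredients are fixed before
    any \<open>eps\<close> is chosen.\<close>
  define C where "C = max 1 (\<Sum>i\<in>(UNIV::'m set). \<Sum>j\<in>(UNIV::'m set). Ct i * (B / \<delta>))"
  have "0 < C" by (simp add: C_def)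
  have bound: "op_norm (H eps (\<i> * of_real w)) \<le> eps * C"
    if eps: "eps \<in> {0<..<eps0}" and w: "w \<in> {a..b}" for eps w
  proof -
    let ?u = "geometry (z eps) eps" and ?s0 = "\<i> * complex_of_real w"
    have u: "?u \<in> K" using geometry_in[OF eps] by (simp add: K_def)
    obtain r where r: "0 < r" "r < dJ"
      and den: "\<And>s. s \<in> sphere ?s0 r \<Longrightarrow> \<delta> \<le> cmod (det (char_mat omega Ct c0 ?u s))"
      using circle[OF u, of ?s0] w by (auto simp: S_def)
    have no_pole: "s \<notin> matrix_poles (transfer_matrix omega Ct c0 (z eps) (Bin eps) eps)"
      if "s \<in> cball ?s0 r" for s
    proof
      assume "s \<in> matrix_poles (transfer_matrix omega Ct c0 (z eps) (Bin eps) eps)"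
      then have "s \<in> matrix_poles (H eps)"
        using assms(19) by simp
      \<comment> \<open>The pole \<open>s\<close> competes in the infimum \<open>dJ\<close>, so it
        cannot lie within \<open>r < dJ\<close> of the centre.\<close>
      then have "dJ \<le> cmod (?s0 - s)"
        unfolding \<open>dJ = _\<close> using eps w
        by (intro cInf_lower bdd_belowI[of _ 0]) auto
      then show False
        using that r by (simp add: dist_norm)
    qed
    have in_T: "s \<in> T" if "s \<in> sphere ?s0 r" for s
    proof -
      have "cmod s \<le> cmod ?s0 + cmod (s - ?s0)"
        by (metis add.commute diff_add_cancel norm_triangle_ineq)
      also have "\<dots> = w + r"
        using that w \<open>0 < a\<close> by (simp add: dist_norm norm_minus_commute norm_mult)
      finally show ?thesis
        using w r by (simp add: T_def)
    qed
    have num: "cmod (det (cramer_mat (char_mat omega Ct c0 ?u s) (mat (s\<^sup>2) ** Bin eps s) i j)) \<le> B"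
      if s: "s \<in> sphere ?s0 r" for s i j
      unfolding B_def
    proof (rule norm_det_le)
      fix k l
      have "cmod (Bin eps s $ k $ j) \<le> cB"
        using norm_entry_le_op_norm cB[OF eps in_T[OF s]] by (rule order_trans)
      moreover have "(cmod s)\<^sup>2 \<le> (b + dJ)\<^sup>2"
        using in_T[OF s] by (intro power_mono) (auto simp: T_def)
      ultimately have "(cmod s)\<^sup>2 * cmod (Bin eps s $ k $ j) \<le> (b + dJ)\<^sup>2 * cB"
        by (intro mult_mono) auto
      then show "cmod (cramer_mat (char_mat omega Ct c0 ?u s) (mat (s\<^sup>2) ** Bin eps s) i j $ k $ l) \<le> c'"
        using c[OF u in_T[OF s]]
        by (auto simp: cramer_mat_def c'_def mat_mult_entry norm_mult norm_power le_max_iff_disj)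
    qed
    have "op_norm (H eps ?s0) \<le> (\<Sum>i\<in>UNIV. \<Sum>j\<in>UNIV. cmod (H eps ?s0 $ i $ j))"
      by (rule op_norm_le_sum_entries)
    also have "\<dots> \<le> (\<Sum>i\<in>(UNIV::'m set). \<Sum>j\<in>(UNIV::'m set). eps * Ct i * (B / \<delta>))"
      unfolding assms(19) using eps assms(14)
      by (intro sum_mono transfer_matrix_entry_bound[OF assms(17)[OF eps] no_pole r(1) \<open>0 < \<delta>\<close> _ _ den num])
        (auto intro: less_imp_le)
    also have "\<dots> = eps * (\<Sum>i\<in>(UNIV::'m set). \<Sum>j\<in>(UNIV::'m set). Ct i * (B / \<delta>))"
      by (simp only: sum_distrib_left mult.assoc)
    also have "\<dots> \<le> eps * C"
      using eps by (intro mult_left_mono) (auto simp: C_def)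
    finally show ?thesis .
  qed
  have inverse_bounds:
    "1 / sup_norm_on {a..b} (\<lambda>w. H eps (\<i> * of_real w)) \<le> ess_sup_norm_on {a..b} R"
    "ereal (1 / (eps * C)) \<le> 1 / sup_norm_on {a..b} (\<lambda>w. H eps (\<i> * of_real w))"
    if "eps \<in> {0<..<eps0}" "measurable_right_inverse {a..b} (\<lambda>w. H eps (\<i> * of_real w)) R" for eps R
    using right_inverse_ess_sup_bounds[OF \<open>a < b\<close> that(2) bound[OF that(1)]] by simp_all
  have divergence: "((\<lambda>eps. ess_sup_norm_on {a..b} (R eps)) \<longlongrightarrow> \<infinity>) (at_right 0)"
    if R: "\<forall>\<^sub>F eps in at_right 0. measurable_right_inverse {a..b} (\<lambda>w. H eps (\<i> * of_real w)) (R eps)" for R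
    unfolding tendsto_PInfty
  proof
    fix x :: real
    \<comment> \<open>For \<open>eps < e\<close> the lower bound \<open>1 / (eps * C)\<close>
      exceeds \<open>\<bar>x\<bar> + 1\<close>, hence \<open>x\<close>; the added 1 keeps the
      denominator positive, and \<open>eps0\<close> keeps \<open>eps\<close> admissible.\<close>
    define e where "e = min eps0 (1 / (C * (\<bar>x\<bar> + 1)))"
    have "0 < e"
      using \<open>0 < eps0\<close> \<open>0 < C\<close> by (simp add: e_def)
    then have "\<forall>\<^sub>F eps in at_right 0. eps \<in> {0<..<e}"
      by (rule eventually_at_right_real)
    with R show "\<forall>\<^sub>F eps in at_right 0. ereal x < ess_sup_norm_on {a..b} (R eps)"
    proof eventually_elim
      case (elim eps)
      then have eps: "eps \<in> {0<..<eps0}" and less: "eps < 1 / (C * (\<bar>x\<bar> + 1))"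
        by (auto simp: e_def)
      have pos: "0 < C * (\<bar>x\<bar> + 1)" "0 < eps * C"
        using \<open>0 < C\<close> eps by simp_all
      have "eps * (C * (\<bar>x\<bar> + 1)) < 1"
        using less by (simp only: pos_less_divide_eq[OF pos(1)])
      then have "(\<bar>x\<bar> + 1) * (eps * C) < 1"
        by (simp only: mult_ac)
      then have "\<bar>x\<bar> + 1 < 1 / (eps * C)"
        by (simp only: pos_less_divide_eq[OF pos(2)])
      then have "x < 1 / (eps * C)"
        by linarith
      then have "ereal x < ereal (1 / (eps * C))" by simp
      also note inverse_bounds(2)[OF eps elim(1)]
      also note inverse_bounds(1)[OF eps elim(1)]
      finally show ?case .
    qed
  qed
  show ?thesis
  \<comment> \<open>The bound \<open>eps * C\<close> carries no explicit factor 1 /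
    \<open>dJ\<close>; taking \<open>C * dJ\<close> puts it into the stated form. This is
    independent of \<open>eps\<close> because \<open>dJ\<close> is an infimum over all
    \<open>eps\<close> at once.\<close>
  proof (intro exI[of _ "C * dJ"] conjI ballI allI impI)
    show "0 < C * dJ"
      using \<open>0 < C\<close> \<open>0 < dJ\<close> by simp
  next
    fix eps assume "eps \<in> {0<..<eps0}"
    then show "sup_norm_on {a..b} (\<lambda>w. H eps (\<i> * of_real w)) \<le> ereal (eps * (C * dJ / dJ))"
      unfolding sup_norm_on_def using bound \<open>0 < dJ\<close> by (intro SUP_least) simp
  next
    fix eps R
    assume *: "eps \<in> {0<..<eps0}" "measurable_right_inverse {a..b} (\<lambda>w. H eps (\<i> * of_real w)) R"
    show "1 / sup_norm_on {a..b} (\<lambda>w. H eps (\<i> * of_real w)) \<le> ess_sup_norm_on {a..b} R"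
      by (rule inverse_bounds(1)[OF *])
    have "dJ / (eps * (C * dJ)) = 1 / (eps * C)"
      using \<open>0 < dJ\<close> by simp
    then show "ereal (dJ / (eps * (C * dJ))) \<le> 1 / sup_norm_on {a..b} (\<lambda>w. H eps (\<i> * of_real w))"
      using inverse_bounds(2)[OF *] by (simp only:)
  qed (rule divergence)
qed

end
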